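(* Let $A$ be an $n\times n$ consensus matrix, let $K\subseteq\{1,\dots,n\}$ be a set of agents, and let $u:\mathbb{N}\to\mathbb{R}^{|K|}$ be exponentially decaying. Then there exist $z\in(0,1)$ and $\bar u\in\mathbb{R}^{|K|}$ such that $$\lim_{t\to\infty}\sum_{\tau=0}^{t}A^{t-\tau}B_Ku(\tau)\preceq(1-z)^{-1}\mathbf{1}\,\pi\,B_K\bar u,$$ where $\preceq$ denotes component-wise inequality, $\mathbf{1}$ is the vector of all ones, and $\pi$ is the row vector with $\pi A=\pi$ and $\pi\mathbf{1}=1$.
   Context: A consensus matrix is a real square matrix that is row stochastic (nonnegative entries, rows summing to one) and primitive. For $K=\{i_1,i_2,\dots\}$, $B_K=[e_{i_1}\ e_{i_2}\ \cdots]$ with $e_i$ the canonical basis vectors of $\mathbb{R}^n$. The function $u$ is exponentially decaying if there exist $z_0\in(0,1)$ and $c\ge 0$ such that every component satisfies $|u_i(t)|\le c\,z_0^{t}$ for all $t\in\mathbb{N}$. *)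

theory Defs
  imports Complex_Main "Jordan_Normal_Form.Matrix"
begin

definition row_stochastic :: "real mat \<Rightarrow> bool" where
  "row_stochastic A \<longleftrightarrow> square_mat A
     \<and> (\<forall>i < dim_row A. \<forall>j < dim_col A. 0 \<le> A $$ (i, j))
     \<and> (\<forall>i < dim_row A. (\<Sum>j < dim_col A. A $$ (i, j)) = 1)"

(* The exponent is required to be positive: with k = 0 the zero 1 x 1 matrix would qualify. *)
definition primitive_mat :: "real mat \<Rightarrow> bool" where
  "primitive_mat A \<longleftrightarrow> square_mat A
     \<and> (\<forall>i < dim_row A. \<forall>j < dim_col A. 0 \<le> A $$ (i, j))
     \<and> (\<exists>k > 0. \<forall>i < dim_row A. \<forall>j < dim_col A. 0 < (A ^\<^sub>m k) $$ (i, j))"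

definition consensus_mat :: "real mat \<Rightarrow> bool" where
  "consensus_mat A \<longleftrightarrow> row_stochastic A \<and> primitive_mat A"

(* Matrix and vector indices are 0-based, so agents are the elements of {..<n} and
   K = {i_1 < i_2 < ...} is enumerated increasingly.  K may be empty; the result is then
   an n x 0 matrix. *)
definition agents_mat :: "nat \<Rightarrow> nat set \<Rightarrow> real mat" where
  "agents_mat n K = mat_of_cols n (map (unit_vec n) (sorted_list_of_set K))"

definition ones_col :: "nat \<Rightarrow> real mat" where
  "ones_col n = mat n 1 (\<lambda>_. 1)"

(* The row vector \<pi>, kept as a 1 x n matrix so that 1 \<pi> is an ordinary matrix product.
   For a consensus matrix it exists and is unique by the Perron-Frobenius theorem. *)
definition consensus_row :: "real mat \<Rightarrow> real mat" where
  "consensus_row A = (THE p. p \<in> carrier_mat 1 (dim_row A) \<and> p * A = p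
     \<and> p * ones_col (dim_row A) = 1\<^sub>m 1)"

definition exp_decaying :: "(nat \<Rightarrow> real vec) \<Rightarrow> bool" where
  "exp_decaying u \<longleftrightarrow> (\<exists>z\<^sub>0 c. 0 < z\<^sub>0 \<and> z\<^sub>0 < 1 \<and> 0 \<le> c
     \<and> (\<forall>t. \<forall>i < dim_vec (u t). \<bar>u t $ i\<bar> \<le> c * z\<^sub>0 ^ t))"

(* The type of vectors carries no topology; convergence in R^n is component-wise. *)
definition vec_tendsto :: "nat \<Rightarrow> (nat \<Rightarrow> real vec) \<Rightarrow> real vec \<Rightarrow> bool" where
  "vec_tendsto n f L \<longleftrightarrow> (\<forall>t. f t \<in> carrier_vec n) \<and> L \<in> carrier_vec n
     \<and> (\<forall>i < n. (\<lambda>t. f t $ i) \<longlonglongrightarrow> L $ i)"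

end

theory Submission
  imports "HOL-Analysis.Uniform_Limit" Defs
begin

(* Multiplying a vector by a row stochastic matrix with all entries at least d leaves its entries
   in an interval shorter by the factor 1 - d, so the columns of the powers of A converge to
   constants and A^t tends to 1 p with p a probability vector.  Passing to the limit in
   A^(t+1) = A^t A gives p A = p, and any q with q A = q and q 1 = 1 satisfies
   q = q A^t -> q 1 p = p, so p = pi.  By Tannery's theorem the convolution then tends to
   1 pi B (sum_tau u(tau)), and since |u(tau)| <= c z0^tau and pi >= 0, the choice z = z0 and
   ubar = c 1 bounds the limit by summing a geometric series. *)

unbundle no vec_syntax

section \<open>Limits of scalar convolutions\<close>

text \<open>Setting the terms beyond \<open>t\<close> to zero turns the finite sum into a series
  over a fixed index set. For a fixed index the term converges as \<open>t\<close> grows, and a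
  bound on the convergent \<open>f\<close> gives a summable majorant independent of
  \<open>t\<close>, so limit and sum may be exchanged.\<close>

lemma tendsto_convolution:
  fixes f g :: "nat \<Rightarrow> real"
  assumes f: "f \<longlonglongrightarrow> F" and g: "summable (\<lambda>t. \<bar>g t\<bar>)"
  shows "(\<lambda>t. \<Sum>\<tau>\<in>{0..t}. f (t - \<tau>) * g \<tau>) \<longlonglongrightarrow> F * suminf g"
proof -
  obtain C where C: "\<And>t. \<bar>f t\<bar> \<le> C"
    using convergent_imp_Bseq[of f] f by (auto simp: convergent_def Bseq_def)
  define a where "a k t = (if k \<le> t then f (t - k) * g k else 0)" for k t
  have lim: "(\<lambda>t. a k t) \<longlonglongrightarrow> F * g k" for k
  \<comment> \<open>After the shift by \<open>k\<close> the cutoff condition always holds and the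
    term is just \<open>f t * g k\<close>.\<close>
  proof (rule LIMSEQ_offset[where k = k])
    show "(\<lambda>t. a k (t + k)) \<longlonglongrightarrow> F * g k"
      unfolding a_def using f by (auto intro!: tendsto_intros)
  qed
  have bound: "norm (a k t) \<le> C * \<bar>g k\<bar>" for k t
    \<comment> \<open>The instance at 0 shows that \<open>C\<close> is nonnegative, which settles
      the case where the term is cut off.\<close>
    using C[of "t - k"] C[of 0] by (simp add: a_def abs_mult mult_right_mono)
  have "\<forall>\<^sub>F (k, t) in sequentially \<times>\<^sub>F sequentially. norm (a k t) \<le> C * \<bar>g k\<bar>"
    using bound by (intro always_eventually) auto
  from tannerys_theorem[OF lim this summable_mult[OF g] sequentially_bot]
  have "(\<lambda>t. suminf (\<lambda>k. a k t)) \<longlonglongrightarrow> suminf (\<lambda>k. F * g k)" by blast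
  moreover have "suminf (\<lambda>k. a k t) = (\<Sum>\<tau>\<in>{0..t}. f (t - \<tau>) * g \<tau>)" for t
    by (subst suminf_finite[of "{0..t}"]) (auto simp: a_def)
  moreover have "suminf (\<lambda>k. F * g k) = F * suminf g"
    by (rule suminf_mult[OF summable_rabs_cancel[OF g]])
  ultimately show ?thesis by simp
qed

section \<open>Entries of powers of a row stochastic matrix\<close>

lemma index_mult_mat_sum:
  assumes "A \<in> carrier_mat m n" "B \<in> carrier_mat n k" "i < m" "j < k"
  shows "(A * B) $$ (i, j) = (\<Sum>l<n. A $$ (i, l) * B $$ (l, j))"
  using assms by (auto simp: scalar_prod_def lessThan_atLeast0)

lemma pow_mat_add:
  fixes A :: "'a :: semiring_1 mat"
  assumes A: "A \<in> carrier_mat n n"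
  shows "A ^\<^sub>m (s + t) = A ^\<^sub>m s * A ^\<^sub>m t"
proof (induction t)
  case 0
  then show ?case using A pow_carrier_mat[OF A, of s] by auto
next
  case (Suc t)
  then show ?case
    using assoc_mult_mat[OF pow_carrier_mat[OF A, of s] pow_carrier_mat[OF A, of t] A] by simp
qed

lemma index_pow_mat_add:
  fixes A :: "'a :: semiring_1 mat"
  assumes "A \<in> carrier_mat n n" "i < n" "j < n"
  shows "(A ^\<^sub>m (s + t)) $$ (i, j) = (\<Sum>l<n. (A ^\<^sub>m s) $$ (i, l) * (A ^\<^sub>m t) $$ (l, j))"
  using assms by (simp only: pow_mat_add index_mult_mat_sum[of _ n n _ n] pow_carrier_mat)

lemma row_stochastic_pow:
  assumes A: "A \<in> carrier_mat n n" and "row_stochastic A"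
  shows "\<And>i j. i < n \<Longrightarrow> j < n \<Longrightarrow> 0 \<le> (A ^\<^sub>m t) $$ (i, j)"
    and "\<And>i. i < n \<Longrightarrow> (\<Sum>j<n. (A ^\<^sub>m t) $$ (i, j)) = 1"
proof -
  have nonneg: "0 \<le> A $$ (i, j)" if "i < n" "j < n" for i j
    using assms that by (auto simp: row_stochastic_def)
  have sum: "(\<Sum>j<n. A $$ (i, j)) = 1" if "i < n" for i
    using assms that by (auto simp: row_stochastic_def)
  have step: "(A ^\<^sub>m Suc t) $$ (i, j) = (\<Sum>l<n. (A ^\<^sub>m t) $$ (i, l) * A $$ (l, j))"
    if "i < n" "j < n" for i j t
    using index_mult_mat_sum[OF pow_carrier_mat[OF A] A that] by simp
  show "0 \<le> (A ^\<^sub>m t) $$ (i, j)" if "i < n" "j < n" for i j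
    using that
  proof (induction t arbitrary: j)
    case 0
    then show ?case using A by simp
  next
    case (Suc t)
    then show ?case using nonneg by (auto simp: step simp del: pow_mat.simps intro!: sum_nonneg)
  qed
  show "(\<Sum>j<n. (A ^\<^sub>m t) $$ (i, j)) = 1" if "i < n" for i
  proof (induction t)
    case 0
    then show ?case using A that by simp
  next
    case (Suc t)
    have "(\<Sum>j<n. (A ^\<^sub>m Suc t) $$ (i, j)) = (\<Sum>j<n. \<Sum>l<n. (A ^\<^sub>m t) $$ (i, l) * A $$ (l, j))"
      using that by (simp add: step del: pow_mat.simps)
    also have "\<dots> = (\<Sum>l<n. (A ^\<^sub>m t) $$ (i, l) * (\<Sum>j<n. A $$ (l, j)))"
      by (subst sum.swap) (simp add: sum_distrib_left)
    also have "\<dots> = 1" using Suc sum by simp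
    finally show ?case .
  qed
qed

section \<open>Contraction of the columns of the powers\<close>

text \<open>Used with a row of a power of \<open>A\<close> as weights and a column of another power
  as values: further multiplication on the left does not leave an interval already reached.\<close>

lemma weighted_mean_bounds:
  fixes w x :: "'a \<Rightarrow> real"
  assumes "\<And>l. l \<in> S \<Longrightarrow> 0 \<le> w l" and "(\<Sum>l\<in>S. w l) = 1"
    and "\<And>l. l \<in> S \<Longrightarrow> x l \<in> {a..b}"
  shows "(\<Sum>l\<in>S. w l * x l) \<in> {a..b}"
proof -
  have "(\<Sum>l\<in>S. w l * a) \<le> (\<Sum>l\<in>S. w l * x l)" "(\<Sum>l\<in>S. w l * x l) \<le> (\<Sum>l\<in>S. w l * b)"
    using assms by (auto intro!: sum_mono mult_left_mono)
  then show ?thesis using assms(2) by (simp flip: sum_distrib_right)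
qed

text \<open>Splitting off mass \<open>d\<close> at the pivot \<open>k\<close> leaves nonnegative
  weights \<open>v\<close> of total \<open>1 - d\<close>. The resulting interval is shorter by the
  factor \<open>1 - d\<close> and does not depend on \<open>w\<close>, so the means formed with
  different rows all lie in the same interval.\<close>

lemma weighted_mean_contraction:
  fixes w x :: "'a \<Rightarrow> real"
  assumes S: "finite S" "k \<in> S" and w: "\<And>l. l \<in> S \<Longrightarrow> 0 \<le> w l" "(\<Sum>l\<in>S. w l) = 1"
    and d: "d \<le> w k" and x: "\<And>l. l \<in> S \<Longrightarrow> x l \<in> {a..b}"
  shows "(\<Sum>l\<in>S. w l * x l) \<in> {d * x k + (1 - d) * a..d * x k + (1 - d) * b}"
proof -
  define v where "v l = w l - (if l = k then d else 0)" for l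
  have v: "0 \<le> v l" if "l \<in> S" for l
    using that w d by (simp add: v_def)
  have sv: "(\<Sum>l\<in>S. v l) = 1 - d"
    using S w by (simp add: v_def sum_subtractf)
  have "(\<Sum>l\<in>S. v l * x l) = (\<Sum>l\<in>S. w l * x l - (if l = k then d * x k else 0))"
    by (rule sum.cong) (auto simp: v_def algebra_simps)
  then have "(\<Sum>l\<in>S. v l * x l) = (\<Sum>l\<in>S. w l * x l) - d * x k"
    using S by (simp add: sum_subtractf)
  moreover have "(\<Sum>l\<in>S. v l * a) \<le> (\<Sum>l\<in>S. v l * x l)" "(\<Sum>l\<in>S. v l * x l) \<le> (\<Sum>l\<in>S. v l * b)"
    using v x by (auto intro!: sum_mono mult_left_mono)
  ultimately show ?thesis using sv by (simp flip: sum_distrib_right)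
qed

text \<open>Each of \<open>m\<close> left multiplications by \<open>A ^\<^sub>m k\<close> contracts
  the interval holding column \<open>j\<close>; any later power is a left multiple of the one at
  \<open>m * k\<close>, hence stays inside.\<close>

lemma consensus_pow_interval:
  assumes n: "0 < n" and A: "A \<in> carrier_mat n n" and "row_stochastic A" and j: "j < n"
    and d: "\<And>i l. i < n \<Longrightarrow> l < n \<Longrightarrow> d \<le> (A ^\<^sub>m k) $$ (i, l)"
  shows "\<exists>a b. b - a = (1 - d) ^ m \<and> (\<forall>t \<ge> m * k. \<forall>i < n. (A ^\<^sub>m t) $$ (i, j) \<in> {a..b})"
proof -
  note st = row_stochastic_pow[OF A \<open>row_stochastic A\<close>]
  have "\<exists>a b. b - a = (1 - d) ^ m \<and> (\<forall>i < n. (A ^\<^sub>m (m * k)) $$ (i, j) \<in> {a..b})"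
  proof (induction m)
    case 0
    \<comment> \<open>The zeroth power is the identity, with entries in the unit interval.\<close>
    show ?case using A j by (intro exI[of _ 0] exI[of _ 1]) auto
  next
    case (Suc m)
    then obtain a b where ab: "b - a = (1 - d) ^ m"
      "\<And>i. i < n \<Longrightarrow> (A ^\<^sub>m (m * k)) $$ (i, j) \<in> {a..b}" by blast
    \<comment> \<open>Every row uses this same pivot value, so the new interval is common to all
      \<open>i\<close>.\<close>
    let ?x = "(A ^\<^sub>m (m * k)) $$ (0, j)"
    have "(A ^\<^sub>m (Suc m * k)) $$ (i, j) \<in> {d * ?x + (1 - d) * a..d * ?x + (1 - d) * b}"
      if "i < n" for i
      unfolding mult_Suc index_pow_mat_add[OF A that j]
      by (rule weighted_mean_contraction[where k = 0]) (use n st d ab that in auto)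
    moreover have "d * ?x + (1 - d) * b - (d * ?x + (1 - d) * a) = (1 - d) ^ Suc m"
      using ab(1) by (simp add: algebra_simps flip: ab(1))
    ultimately show ?case by blast
  qed
  then obtain a b where ab: "b - a = (1 - d) ^ m"
    "\<And>i. i < n \<Longrightarrow> (A ^\<^sub>m (m * k)) $$ (i, j) \<in> {a..b}" by blast
  have "(A ^\<^sub>m t) $$ (i, j) \<in> {a..b}" if "m * k \<le> t" "i < n" for t i
  proof -
    have "(A ^\<^sub>m ((t - m * k) + m * k)) $$ (i, j) \<in> {a..b}"
      unfolding index_pow_mat_add[OF A that(2) j]
      by (rule weighted_mean_bounds) (use st ab that in auto)
    then show ?thesis using that by simp
  qed
  with ab(1) show ?thesis by blast
qed

lemma consensus_pow_column_tendsto: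
  assumes n: "0 < n" and A: "A \<in> carrier_mat n n" and "consensus_mat A" and j: "j < n"
  shows "\<exists>p. \<forall>i < n. (\<lambda>t. (A ^\<^sub>m t) $$ (i, j)) \<longlonglongrightarrow> p"
proof -
  have rs: "row_stochastic A" and "primitive_mat A"
    using \<open>consensus_mat A\<close> by (auto simp: consensus_mat_def)
  note st = row_stochastic_pow[OF A rs]
  obtain k where pos: "\<And>i l. i < n \<Longrightarrow> l < n \<Longrightarrow> 0 < (A ^\<^sub>m k) $$ (i, l)"
    using \<open>primitive_mat A\<close> A unfolding primitive_mat_def by (metis carrier_matD)
  \<comment> \<open>The smallest entry of the positive power; as a minimum of finitely many positive
    numbers it is positive.\<close>
  define d where "d = Min ((\<lambda>(i, l). (A ^\<^sub>m k) $$ (i, l)) ` ({..<n} \<times> {..<n}))"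
  have d: "d \<le> (A ^\<^sub>m k) $$ (i, l)" if "i < n" "l < n" for i l
    unfolding d_def using that by (intro Min_le) auto
  have "0 < d" unfolding d_def using n pos by (subst Min_gr_iff) auto
  have "d \<le> 1"
  proof -
    have "(A ^\<^sub>m k) $$ (0, 0) \<le> (\<Sum>l<n. (A ^\<^sub>m k) $$ (0, l))"
      using n st by (intro member_le_sum) auto
    then show ?thesis using d[OF n n] st(2)[OF n] by simp
  qed
  \<comment> \<open>Exponents and rows vary independently: taking both rows to be 0 gives the Cauchy
    property, while equal exponents show that the rows approach each other and so share one
    limit.\<close>
  have small: "\<exists>N. \<forall>s \<ge> N. \<forall>t \<ge> N. \<forall>i < n. \<forall>i' < n.
      \<bar>(A ^\<^sub>m s) $$ (i, j) - (A ^\<^sub>m t) $$ (i', j)\<bar> < e" if "0 < e" for e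
  proof -
    obtain m where "(1 - d) ^ m < e"
      using real_arch_pow_inv[OF \<open>0 < e\<close>, of "1 - d"] \<open>0 < d\<close> by auto
    moreover obtain a b where "b - a = (1 - d) ^ m"
      "\<forall>t \<ge> m * k. \<forall>i < n. (A ^\<^sub>m t) $$ (i, j) \<in> {a..b}"
      using consensus_pow_interval[OF n A rs j d] by blast
    ultimately have ab: "b - a < e"
      "\<And>t i. t \<ge> m * k \<Longrightarrow> i < n \<Longrightarrow> a \<le> (A ^\<^sub>m t) $$ (i, j) \<and> (A ^\<^sub>m t) $$ (i, j) \<le> b"
      by auto
    have "\<bar>(A ^\<^sub>m s) $$ (i, j) - (A ^\<^sub>m t) $$ (i', j)\<bar> < e"
      if "s \<ge> m * k" "t \<ge> m * k" "i < n" "i' < n" for s t i i'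
      using ab(1) ab(2)[of s i] ab(2)[of t i'] that by linarith
    then show ?thesis by blast
  qed
  have "Cauchy (\<lambda>t. (A ^\<^sub>m t) $$ (0, j))"
  proof (rule CauchyI)
    fix e :: real assume "0 < e"
    from small[OF this] n
    show "\<exists>N. \<forall>s \<ge> N. \<forall>t \<ge> N. norm ((A ^\<^sub>m s) $$ (0, j) - (A ^\<^sub>m t) $$ (0, j)) < e"
      unfolding real_norm_def by meson
  qed
  then obtain p where p: "(\<lambda>t. (A ^\<^sub>m t) $$ (0, j)) \<longlonglongrightarrow> p"
    using real_Cauchy_convergent convergent_def by blast
  have "(\<lambda>t. (A ^\<^sub>m t) $$ (i, j)) \<longlonglongrightarrow> p" if "i < n" for i
  proof -
    have "(\<lambda>t. (A ^\<^sub>m t) $$ (i, j) - (A ^\<^sub>m t) $$ (0, j)) \<longlonglongrightarrow> 0"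
    proof (rule LIMSEQ_I)
      fix e :: real assume "0 < e"
      from small[OF this] n that
      show "\<exists>N. \<forall>t \<ge> N. norm ((A ^\<^sub>m t) $$ (i, j) - (A ^\<^sub>m t) $$ (0, j) - 0) < e"
        unfolding real_norm_def diff_0_right by meson
    qed
    from tendsto_add[OF this p] show ?thesis by simp
  qed
  then show ?thesis by blast
qed

section \<open>Identification of the limit row with the stationary row\<close>

text \<open>Since \<open>consensus_row\<close> is a definite description, the limit row
  \<open>P\<close> must be shown to satisfy its conditions and to be the only row doing so.\<close>

lemma consensus_pow_tendsto:
  assumes n: "0 < n" and A: "A \<in> carrier_mat n n" and cons: "consensus_mat A"
  shows "consensus_row A \<in> carrier_mat 1 n"
    and "\<And>i j. i < n \<Longrightarrow> j < n \<Longrightarrow> (\<lambda>t. (A ^\<^sub>m t) $$ (i, j)) \<longlonglongrightarrow> consensus_row A $$ (0, j)"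
proof -
  have rs: "row_stochastic A" using cons by (simp add: consensus_mat_def)
  note st = row_stochastic_pow[OF A rs]
  obtain p where p: "\<And>i j. i < n \<Longrightarrow> j < n \<Longrightarrow> (\<lambda>t. (A ^\<^sub>m t) $$ (i, j)) \<longlonglongrightarrow> p j"
    using consensus_pow_column_tendsto[OF n A cons] by metis
  define P where "P = mat 1 n (\<lambda>(_, j). p j)"
  have P: "P \<in> carrier_mat 1 n" by (simp add: P_def)
  have "(\<lambda>t. \<Sum>j<n. (A ^\<^sub>m t) $$ (0, j)) \<longlonglongrightarrow> (\<Sum>j<n. p j)"
    using p n by (intro tendsto_sum) auto
  then have sum: "(\<Sum>j<n. p j) = 1"
    using st(2)[OF n] by (simp add: LIMSEQ_const_iff)
  \<comment> \<open>Both sides are limits of the entry \<open>(0, j)\<close> of the power with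
    exponent \<open>Suc t\<close>.\<close>
  have stat: "(\<Sum>l<n. p l * A $$ (l, j)) = p j" if "j < n" for j
  proof -
    have "(\<lambda>t. \<Sum>l<n. (A ^\<^sub>m t) $$ (0, l) * A $$ (l, j)) \<longlonglongrightarrow> (\<Sum>l<n. p l * A $$ (l, j))"
      using p n by (intro tendsto_intros) auto
    moreover have "(\<lambda>t. \<Sum>l<n. (A ^\<^sub>m t) $$ (0, l) * A $$ (l, j)) = (\<lambda>t. (A ^\<^sub>m Suc t) $$ (0, j))"
      using index_mult_mat_sum[OF pow_carrier_mat[OF A] A n that] by simp
    ultimately show ?thesis
      using LIMSEQ_unique[OF _ LIMSEQ_Suc[OF p[OF n that]]] by simp
  qed
  have PA: "P * A = P"
  proof (rule eq_matI)
    fix i j assume "i < dim_row P" "j < dim_col P"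
    then show "(P * A) $$ (i, j) = P $$ (i, j)"
      using index_mult_mat_sum[OF P A, of i j] stat P by (simp add: P_def)
  qed (use A P in auto)
  have P1: "P * ones_col n = 1\<^sub>m 1"
    by (rule eq_matI) (auto simp: P_def ones_col_def scalar_prod_def sum lessThan_atLeast0[symmetric])
  have unique: "Q = P" if Q: "Q \<in> carrier_mat 1 n" "Q * A = Q" "Q * ones_col n = 1\<^sub>m 1" for Q
  proof (rule eq_matI)
    have Qt: "Q * A ^\<^sub>m t = Q" for t
    proof (induction t)
      case 0
      then show ?case using A Q by simp
    next
      case (Suc t)
      then show ?case
        using assoc_mult_mat[OF Q(1) pow_carrier_mat[OF A, of t] A] Q(2) by simp
    qed
    have "(\<Sum>l<n. Q $$ (0, l)) = (Q * ones_col n) $$ (0, 0)"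
      using Q(1) by (simp add: ones_col_def scalar_prod_def lessThan_atLeast0)
    then have sQ: "(\<Sum>l<n. Q $$ (0, l)) = 1" by (simp add: Q(3))
    fix i j assume ij: "i < dim_row P" "j < dim_col P"
    then have "i = 0" "j < n" using P by auto
    \<comment> \<open>By \<open>Qt\<close> this sequence is constantly \<open>Q $$ (0, j)\<close>;
      its limit is \<open>p j\<close> times the total of \<open>Q\<close>, which is one.\<close>
    have "(\<lambda>t. \<Sum>l<n. Q $$ (0, l) * (A ^\<^sub>m t) $$ (l, j)) \<longlonglongrightarrow> (\<Sum>l<n. Q $$ (0, l) * p j)"
      using p \<open>j < n\<close> by (intro tendsto_intros) auto
    moreover have "(\<Sum>l<n. Q $$ (0, l) * (A ^\<^sub>m t) $$ (l, j)) = Q $$ (0, j)" for t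
      using index_mult_mat_sum[OF Q(1) pow_carrier_mat[OF A, of t], of 0 j] \<open>j < n\<close> Qt by simp
    ultimately have "Q $$ (0, j) = (\<Sum>l<n. Q $$ (0, l) * p j)"
      by (simp add: LIMSEQ_const_iff)
    then show "Q $$ (i, j) = P $$ (i, j)"
      using sQ \<open>i = 0\<close> \<open>j < n\<close> by (simp add: P_def flip: sum_distrib_right)
  qed (use P Q in auto)
  have "consensus_row A = P"
    unfolding consensus_row_def carrier_matD(1)[OF A]
    by (rule the_equality) (use P PA P1 unique in blast)+
  then show "consensus_row A \<in> carrier_mat 1 n"
    and "\<And>i j. i < n \<Longrightarrow> j < n \<Longrightarrow> (\<lambda>t. (A ^\<^sub>m t) $$ (i, j)) \<longlonglongrightarrow> consensus_row A $$ (0, j)"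
    using P p by (auto simp: P_def)
qed

section \<open>Products with the agent selection matrix\<close>

lemma nth_sorted_list_of_set_less:
  fixes n :: nat
  assumes "K \<subseteq> {..<n}" and "l < card K"
  shows "sorted_list_of_set K ! l < n"
proof -
  have "finite K" using assms(1) finite_subset by blast
  then have "sorted_list_of_set K ! l \<in> K" using assms
    by (metis nth_mem set_sorted_list_of_set length_sorted_list_of_set)
  then show ?thesis using assms by auto
qed

lemma agents_mat_carrier: "K \<subseteq> {..<n} \<Longrightarrow> agents_mat n K \<in> carrier_mat n (card K)"
  using finite_subset[of K "{..<n}"] by (simp add: agents_mat_def carrier_matI)

lemma mult_agents_mat:
  assumes M: "M \<in> carrier_mat m n" and K: "K \<subseteq> {..<n}" and "i < m" "l < card K"
  shows "(M * agents_mat n K) $$ (i, l) = M $$ (i, sorted_list_of_set K ! l)"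
proof -
  have "finite K" using K finite_subset by blast
  then have "col (agents_mat n K) l = unit_vec n (sorted_list_of_set K ! l)"
    using assms by (simp add: agents_mat_def)
  then show ?thesis
    using assms agents_mat_carrier[OF K] nth_sorted_list_of_set_less[OF K \<open>l < card K\<close>] by simp
qed

text \<open>Selecting columns reduces the matrix products to scalar sums over the agents, the form
  in which scalar convolutions appear.\<close>

lemma mult_agents_mat_vec:
  assumes M: "M \<in> carrier_mat m n" and K: "K \<subseteq> {..<n}" and v: "v \<in> carrier_vec (card K)" and "i < m"
  shows "((M * agents_mat n K) *\<^sub>v v) $ i = (\<Sum>l<card K. M $$ (i, sorted_list_of_set K ! l) * v $ l)"
proof -
  have "((M * agents_mat n K) *\<^sub>v v) $ i = (\<Sum>l<card K. (M * agents_mat n K) $$ (i, l) * v $ l)"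
    using assms agents_mat_carrier[OF K]
    by (simp add: scalar_prod_def lessThan_atLeast0 del: assoc_mult_mat_vec)
  then show ?thesis using mult_agents_mat[OF M K \<open>i < m\<close>] by simp
qed

text \<open>All rows of \<open>ones_col n * consensus_row A\<close> equal the stationary row, which
  is why the value does not depend on \<open>i\<close>.\<close>

lemma ones_consensus_agents_mult_vec:
  assumes P: "consensus_row A \<in> carrier_mat 1 n" and K: "K \<subseteq> {..<n}"
    and v: "v \<in> carrier_vec (card K)" and i: "i < n"
  shows "((ones_col n * consensus_row A * agents_mat n K) *\<^sub>v v) $ i
    = (\<Sum>l<card K. consensus_row A $$ (0, sorted_list_of_set K ! l) * v $ l)"
proof -
  have O: "ones_col n \<in> carrier_mat n 1" by (simp add: ones_col_def)
  have "(ones_col n * consensus_row A) $$ (i, j) = consensus_row A $$ (0, j)" if "j < n" for j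
    using index_mult_mat_sum[OF O P i that] i by (simp add: ones_col_def)
  then show ?thesis
    using nth_sorted_list_of_set_less[OF K]
    unfolding mult_agents_mat_vec[OF mult_carrier_mat[OF O P] K v i] by (intro sum.cong) auto
qed

section \<open>Limit of the matrix convolution and its bound\<close>

text \<open>The entries are limits of nonnegative entries of powers. This sign lets upper bounds on
  the summed inputs pass to their weighted sum.\<close>

lemma consensus_row_nonneg:
  assumes n: "0 < n" and A: "A \<in> carrier_mat n n" and cons: "consensus_mat A" and j: "j < n"
  shows "0 \<le> consensus_row A $$ (0, j)"
proof (rule LIMSEQ_le_const[OF consensus_pow_tendsto(2)[OF n A cons n j]])
  show "\<exists>N. \<forall>t\<ge>N. 0 \<le> (A ^\<^sub>m t) $$ (0, j)"
    using row_stochastic_pow(1)[OF A _ n j] cons by (simp add: consensus_mat_def)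
qed

text \<open>After exchanging the two finite sums, entry \<open>i\<close> is a sum over agents of
  scalar convolutions of powers with inputs. As the powers have the same limit in every row, so does
  the convolution.\<close>

lemma consensus_convolution_tendsto:
  assumes n: "0 < n" and A: "A \<in> carrier_mat n n" and cons: "consensus_mat A"
    and K: "K \<subseteq> {..<n}" and u: "\<And>t. u t \<in> carrier_vec (card K)"
    and summ: "\<And>l. l < card K \<Longrightarrow> summable (\<lambda>t. \<bar>u t $ l\<bar>)"
  shows "vec_tendsto n
    (\<lambda>t. finsum_vec TYPE(real) n (\<lambda>\<tau>. (A ^\<^sub>m (t - \<tau>) * agents_mat n K) *\<^sub>v u \<tau>) {0..t})
    (vec n (\<lambda>_. \<Sum>l<card K. consensus_row A $$ (0, sorted_list_of_set K ! l) * (\<Sum>t. u t $ l)))"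
    (is "vec_tendsto n (\<lambda>t. finsum_vec _ n (?X t) _) (vec n (\<lambda>_. ?L))")
  unfolding vec_tendsto_def
proof (intro conjI allI impI)
  note B = agents_mat_carrier[OF K]
  have X: "?X t \<tau> \<in> carrier_vec n" for t \<tau>
    using mult_mat_vec_carrier[OF mult_carrier_mat[OF pow_carrier_mat[OF A] B] u] .
  show "finsum_vec TYPE(real) n (?X t) {0..t} \<in> carrier_vec n" for t
    using X by (intro finsum_vec_closed) auto
  fix i assume i: "i < n"
  let ?a = "\<lambda>t l. (A ^\<^sub>m t) $$ (i, sorted_list_of_set K ! l)"
  have "finsum_vec TYPE(real) n (?X t) {0..t} $ i
      = (\<Sum>l<card K. \<Sum>\<tau>\<in>{0..t}. ?a (t - \<tau>) l * u \<tau> $ l)" for t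
  proof -
    have "finsum_vec TYPE(real) n (?X t) {0..t} $ i = (\<Sum>\<tau>\<in>{0..t}. ?X t \<tau> $ i)"
      using X i by (intro index_finsum_vec) auto
    also have "\<dots> = (\<Sum>\<tau>\<in>{0..t}. \<Sum>l<card K. ?a (t - \<tau>) l * u \<tau> $ l)"
      by (intro sum.cong refl mult_agents_mat_vec[OF pow_carrier_mat[OF A] K u i])
    also have "\<dots> = (\<Sum>l<card K. \<Sum>\<tau>\<in>{0..t}. ?a (t - \<tau>) l * u \<tau> $ l)"
      by (rule sum.swap)
    finally show ?thesis .
  qed
  moreover have "(\<lambda>t. \<Sum>l<card K. \<Sum>\<tau>\<in>{0..t}. ?a (t - \<tau>) l * u \<tau> $ l) \<longlonglongrightarrow> ?L"
    using consensus_pow_tendsto(2)[OF n A cons i] nth_sorted_list_of_set_less[OF K] summ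
    by (intro tendsto_sum tendsto_convolution) auto
  ultimately show "(\<lambda>t. finsum_vec TYPE(real) n (?X t) {0..t} $ i) \<longlonglongrightarrow> vec n (\<lambda>_. ?L) $ i"
    using i by simp
qed simp

theorem lemmaV3:
  fixes n :: nat and A :: "real mat" and K :: "nat set" and u :: "nat \<Rightarrow> real vec"
  assumes "0 < n"
    and "A \<in> carrier_mat n n" and "consensus_mat A"
    and "K \<subseteq> {..<n}"
    and "\<And>t. u t \<in> carrier_vec (card K)" and "exp_decaying u"
  shows "\<exists>(z::real) (ubar::real vec). 0 < z \<and> z < 1 \<and> ubar \<in> carrier_vec (card K) \<and>
    (\<exists>L. vec_tendsto n
           (\<lambda>t. finsum_vec TYPE(real) n
                  (\<lambda>\<tau>. (A ^\<^sub>m (t - \<tau>) * agents_mat n K) *\<^sub>v u \<tau>) {0..t}) L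
       \<and> L \<le> inverse (1 - z) \<cdot>\<^sub>v
              ((ones_col n * consensus_row A * agents_mat n K) *\<^sub>v ubar))"
proof -
  note n = \<open>0 < n\<close> and A = \<open>A \<in> carrier_mat n n\<close> and cons = \<open>consensus_mat A\<close>
    and K = \<open>K \<subseteq> {..<n}\<close> and u = \<open>\<And>t. u t \<in> carrier_vec (card K)\<close>
  let ?p = "\<lambda>l. consensus_row A $$ (0, sorted_list_of_set K ! l)"
  obtain z c where z: "0 < z" "z < 1"
    and "\<And>t i. i < dim_vec (u t) \<Longrightarrow> \<bar>u t $ i\<bar> \<le> c * z ^ t"
    using \<open>exp_decaying u\<close> unfolding exp_decaying_def by blast
  then have decay: "\<bar>u t $ l\<bar> \<le> c * z ^ t" if "l < card K" for t l
    using u[of t] that by auto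
  \<comment> \<open>With \<open>z\<close> the decay rate of the input, this series is the source of
    the factor \<open>inverse (1 - z)\<close>.\<close>
  have geom: "(\<lambda>t. c * z ^ t) sums (c * inverse (1 - z))"
    using sums_mult[OF geometric_sums[of z], of c] z by (simp add: inverse_eq_divide)
  have summ: "summable (\<lambda>t. \<bar>u t $ l\<bar>)" if "l < card K" for l
    using decay[OF that] by (intro summable_comparison_test'[OF sums_summable[OF geom]]) auto
  have total: "(\<Sum>t. u t $ l) \<le> c * inverse (1 - z)" if "l < card K" for l
    using decay[OF that] summable_rabs_cancel[OF summ[OF that]] sums_summable[OF geom]
    unfolding sums_unique[OF geom] by (intro suminf_le) (auto simp: abs_le_iff)
  have "(\<Sum>l<card K. ?p l * (\<Sum>t. u t $ l)) \<le> (\<Sum>l<card K. ?p l * (c * inverse (1 - z)))"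
    using total consensus_row_nonneg[OF n A cons] nth_sorted_list_of_set_less[OF K]
    by (intro sum_mono mult_left_mono) auto
  \<comment> \<open>The remaining sum is the common entry of the right-hand vector for the constant
    choice \<open>vec (card K) (\<lambda>_. c)\<close> of \<open>ubar\<close>.\<close>
  also have "\<dots> = inverse (1 - z) * (\<Sum>l<card K. ?p l * c)"
    by (simp add: sum_distrib_left mult_ac)
  finally have le: "vec n (\<lambda>_. \<Sum>l<card K. ?p l * (\<Sum>t. u t $ l)) \<le> inverse (1 - z) \<cdot>\<^sub>v
      ((ones_col n * consensus_row A * agents_mat n K) *\<^sub>v vec (card K) (\<lambda>_. c))"
    using ones_consensus_agents_mult_vec[OF consensus_pow_tendsto(1)[OF n A cons] K,
        of "vec (card K) (\<lambda>_. c)"]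
    by (simp add: less_eq_vec_def ones_col_def del: assoc_mult_mat_vec)
  show ?thesis
    using z le consensus_convolution_tendsto[OF n A cons K u summ] vec_carrier by blast
qed

end
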